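(* Let $f(s,t)$ and $g(s,t)$ be two super-additive bivariate real-valued functions defined for $t\ge s\ge 0$. Then the pointwise minimum $h(s,t)=\min\{f(s,t),g(s,t)\}$ is super-additive.
   Context: A bivariate function $f(s,t)$, $t\ge s\ge 0$, is called super-additive if $f(s,u)\ge f(s,t)+f(t,u)$ for all $u\ge t\ge s\ge 0$. *)

theory Defs
  imports Complex_Main
begin

text \<open>
  A bivariate function with domain \<open>{(s, t). 0 \<le> s \<and> s \<le> t}\<close> is represented by a total curried
  function; its values outside this domain are never constrained.
\<close>

definition super_additive :: "(real \<Rightarrow> real \<Rightarrow> real) \<Rightarrow> bool" where
  "super_additive f \<longleftrightarrow> (\<forall>s t u. 0 \<le> s \<and> s \<le> t \<and> t \<le> u \<longrightarrow> f s u \<ge> f s t + f t u)"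

end

theory Submission imports Defs begin

theorem lemma2:
  fixes f g :: "real \<Rightarrow> real \<Rightarrow> real"
  assumes "super_additive f"
    and "super_additive g"
  shows "super_additive (\<lambda>s t. min (f s t) (g s t))"
  \<comment> \<open>The minimum at \<open>(s, u)\<close> is attained by \<open>f\<close> or by
    \<open>g\<close>. If by \<open>f\<close>, then super-additivity of \<open>f\<close> bounds it
    below by \<open>f s t + f t u\<close>, and each summand dominates the minimum at its own pair,
    \<open>(s, t)\<close> or \<open>(t, u)\<close>. The case of \<open>g\<close> is symmetric, so
    what remains is linear arithmetic with a case split on each \<open>min\<close>.\<close>
  using assms unfolding super_additive_def by (smt (verit))

end
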